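(* Let $M,N$ be positive integers and $n$ a nonnegative integer. There exists a bijection $\psi$ between $C_{M,N}(n)$ and $D_{M,N}(n)$.
   Context: For a partition $\lambda$, $|\lambda|$ denotes the sum of its parts. $C_{M,N}(n)$ is the set of partitions $\delta=(\delta_1,\delta_2,\ldots,\delta_N)$ of $n$ into $N$ nonnegative parts (that is, integers with $\delta_1\ge\cdots\ge\delta_N\ge 0$ and sum $n$) such that $0\le \delta_i-\delta_{i+1}\le M+N-i$ for $1\le i\le N$, with the convention $\delta_{N+1}=0$. $D_{M,N}(n)$ is the set of pairs of partitions $(\pi,\mu)$ such that: all parts of $\pi$ lie in $[M+1,M+N-1]$ and for each $i$ the number of appearances of $M+i$ as a part of $\pi$ does not exceed $N-i$; $\mu=(\mu_1,\ldots,\mu_N)$ is a partition with $N$ nonnegative parts (at most $N$ positive parts), each part less than or equal to $M$; and $|\pi|+|\mu|=n$. *)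

theory Defs
  imports Main
begin

text \<open>
  A partition is the list of its parts in weakly decreasing order; whether zero parts are
  allowed is stated where it matters. The weight of a partition is \<^const>\<open>sum_list\<close>.
\<close>

abbreviation is_partition :: "nat list \<Rightarrow> bool" where
  "is_partition xs \<equiv> sorted_wrt (\<ge>) xs"

text \<open>One-based access to the parts, with the convention that parts beyond the last one are zero.\<close>

definition part :: "nat list \<Rightarrow> nat \<Rightarrow> nat" where
  "part xs i = (if 1 \<le> i \<and> i \<le> length xs then xs ! (i - 1) else 0)"

text \<open>The differences are taken in \<^typ>\<open>int\<close> to avoid truncated subtraction.\<close>

definition C_set :: "nat \<Rightarrow> nat \<Rightarrow> nat \<Rightarrow> nat list set" where
  "C_set M N n = {\<delta>. length \<delta> = N \<and> is_partition \<delta> \<and> sum_list \<delta> = n \<and>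
     (\<forall>i\<in>{1..N}. 0 \<le> int (part \<delta> i) - int (part \<delta> (i + 1)) \<and>
                 int (part \<delta> i) - int (part \<delta> (i + 1)) \<le> int M + int N - int i)}"

text \<open>
  The first component has no zero parts, since its parts are at least \<open>M + 1\<close>, and its length is
  not fixed; the second one is padded with zeros to length \<open>N\<close>. For \<open>N = 1\<close> the first component
  is empty.
\<close>

definition D_set :: "nat \<Rightarrow> nat \<Rightarrow> nat \<Rightarrow> (nat list \<times> nat list) set" where
  "D_set M N n = {(\<pi>, \<mu>).
     is_partition \<pi> \<and> set \<pi> \<subseteq> {M + 1..M + N - 1} \<and>
     (\<forall>i\<in>{1..N - 1}. count_list \<pi> (M + i) \<le> N - i) \<and>
     length \<mu> = N \<and> is_partition \<mu> \<and> (\<forall>p\<in>set \<mu>. p \<le> M) \<and>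
     sum_list \<pi> + sum_list \<mu> = n}"

end

theory Submission
  imports Defs "HOL-Computational_Algebra.Polynomial"
begin

text \<open>
  Both sets are finite, so it suffices that they have the same cardinality for every \<open>n\<close>, and this
  is read off from the generating polynomials in \<open>q\<close>, the weight \<open>n\<close> being recorded by the exponent.

  An element of \<open>C\<close> is determined by its differences \<open>d\<^sub>i = \<delta>\<^sub>i - \<delta>\<^sub>i\<^sub>+\<^sub>1\<close>, which range independently
  over \<open>0, \<dots>, M + N - i\<close> and contribute \<open>i d\<^sub>i\<close> to the weight. The generating polynomial of \<open>C\<close> is
  therefore a product of geometric sums:
  \<open>\<Prod>\<^sub>1\<^sub>\<le>\<^sub>i\<^sub>\<le>\<^sub>N (1 - q ^ (i (M + N - i + 1))) / (1 - q ^ i)\<close>.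

  In a pair \<open>(\<pi>, \<mu>)\<close> the multiplicities of the parts of \<open>\<pi>\<close> are independent as well and give
  \<open>\<Prod>\<^sub>1\<^sub>\<le>\<^sub>i\<^sub><\<^sub>N (1 - q ^ ((M + i) (N - i + 1))) / (1 - q ^ (M + i))\<close>, while \<open>\<mu>\<close> fits into an \<open>N\<close> by \<open>M\<close>
  box and gives the Gaussian binomial coefficient
  \<open>\<Prod>\<^sub>1\<^sub>\<le>\<^sub>i\<^sub>\<le>\<^sub>N (1 - q ^ (M + i)) / (1 - q ^ i)\<close>. The factors \<open>1 - q ^ (M + i)\<close> with \<open>i < N\<close> cancel,
  the one with \<open>i = N\<close> extends the numerator product of \<open>\<pi>\<close> to \<open>i = N\<close>, and the substitution
  \<open>i \<mapsto> N + 1 - i\<close> turns the result into the generating polynomial of \<open>C\<close>.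
\<close>

section \<open>Generating polynomials of weighted sets\<close>

text \<open>The indeterminate of the generating polynomials.\<close>

abbreviation q :: "int poly" where
  "q \<equiv> monom 1 1"

text \<open>
  The generating polynomial of a set \<open>A\<close> with weight function \<open>w\<close>. It is meaningful for finite \<open>A\<close>
  only: on infinite sets the sum is zero by convention.
\<close>

definition gen_poly :: "('a \<Rightarrow> nat) \<Rightarrow> 'a set \<Rightarrow> int poly" where
  "gen_poly w A = (\<Sum>a\<in>A. q ^ w a)"

lemma coeff_gen_poly:
  assumes "finite A"
  shows "coeff (gen_poly w A) n = int (card {a \<in> A. w a = n})"
proof -
  have "coeff (gen_poly w A) n = (\<Sum>a\<in>A. if w a = n then 1 else 0)"
    by (simp add: gen_poly_def coeff_sum monom_power)
  also have "\<dots> = int (card {a \<in> A. w a = n})"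
    using assms by (simp add: sum.If_cases Int_def)
  finally show ?thesis .
qed

lemma gen_poly_Times:
  "gen_poly (\<lambda>(a, b). v a + w b) (A \<times> B) = gen_poly v A * gen_poly w B"
  by (simp add: gen_poly_def sum_product sum.cartesian_product power_add case_prod_unfold)

lemma gen_poly_bij_betw:
  assumes "bij_betw h A B" and "\<And>a. a \<in> A \<Longrightarrow> w (h a) = v a"
  shows "gen_poly w B = gen_poly v A"
  unfolding gen_poly_def using assms(2) sum.reindex_bij_betw[OF assms(1), of "\<lambda>b. q ^ w b"]
  by simp

text \<open>
  A family of sets built up by choosing numbers \<open>0 \<le> d\<^sub>i \<le> c\<^sub>i\<close> independently, where \<open>d\<^sub>i\<close> contributes
  \<open>k\<^sub>i d\<^sub>i\<close> to the weight, has a product of geometric sums as its generating polynomial. The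
  denominator is kept on the left-hand side.
\<close>

lemma gen_poly_independent_choices:
  fixes A :: "nat \<Rightarrow> 'a set"
  assumes "finite (A 0)" and "gen_poly w (A 0) = 1"
    and bij: "\<And>m. bij_betw (h m) (A m \<times> {..c (Suc m)}) (A (Suc m))"
    and weight: "\<And>m a d. a \<in> A m \<Longrightarrow> w (h m (a, d)) = w a + k (Suc m) * d"
  shows "finite (A m) \<and>
    gen_poly w (A m) * (\<Prod>i=1..m. 1 - q ^ k i) = (\<Prod>i=1..m. 1 - q ^ (k i * Suc (c i)))"
proof (induction m)
  case 0
  then show ?case using assms by simp
next
  case (Suc m)
  have fin: "finite (A (Suc m))"
    using Suc.IH bij[of m] bij_betw_finite by blast
  have geo: "gen_poly (\<lambda>d. l * d) {..b} * (1 - q ^ l) = 1 - q ^ (l * Suc b)" for l b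
    using sum_gp_basic[of "q ^ l" b] unfolding gen_poly_def power_mult[symmetric]
    by (simp add: mult.commute)
  have "gen_poly w (A (Suc m)) =
      gen_poly (\<lambda>(a, d). w a + k (Suc m) * d) (A m \<times> {..c (Suc m)})"
    using bij[of m] weight by (intro gen_poly_bij_betw) auto
  also have "\<dots> = gen_poly w (A m) * gen_poly (\<lambda>d. k (Suc m) * d) {..c (Suc m)}"
    by (rule gen_poly_Times)
  finally have "gen_poly w (A (Suc m)) * (\<Prod>i=1..Suc m. 1 - q ^ k i) =
      (gen_poly w (A m) * (\<Prod>i=1..m. 1 - q ^ k i)) *
      (gen_poly (\<lambda>d. k (Suc m) * d) {..c (Suc m)} * (1 - q ^ k (Suc m)))"
    by (simp add: mult_ac)
  also have "\<dots> = (\<Prod>i=1..Suc m. 1 - q ^ (k i * Suc (c i)))"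
    unfolding geo using Suc.IH by simp
  finally show ?case using fin by simp
qed

section \<open>Partitions with bounded differences\<close>

text \<open>
  Partitions with \<open>m\<close> nonnegative parts whose \<open>i\<close>-th difference is at most \<open>c i\<close>, for
  \<open>1 \<le> i \<le> m\<close>.
\<close>

definition bounded_diff :: "(nat \<Rightarrow> nat) \<Rightarrow> nat \<Rightarrow> nat list set" where
  "bounded_diff c m = {\<delta>. length \<delta> = m \<and> is_partition \<delta> \<and>
     (\<forall>i\<in>{1..m}. part \<delta> i \<le> part \<delta> (i + 1) + c i)}"

text \<open>
  The last difference \<open>d\<close> equals the last part. Subtracting it from all parts does not change the
  other differences, so what is left after dropping the last part is unconstrained by \<open>d\<close>.
\<close>

lemma bounded_diff_append:
  "map (\<lambda>x. x + d) \<delta> @ [d] \<in> bounded_diff c (Suc m) \<longleftrightarrow> \<delta> \<in> bounded_diff c m \<and> d \<le> c (Suc m)"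
proof (cases "length \<delta> = m")
  case True
  let ?\<epsilon> = "map (\<lambda>x. x + d) \<delta> @ [d]"
  have "part ?\<epsilon> i = part \<delta> i + d" if "i \<in> {1..Suc m}" for i
    using that True by (cases "i = Suc m") (auto simp: Defs.part_def nth_append)
  moreover have "part ?\<epsilon> (Suc (Suc m)) = 0"
    using True by (simp add: Defs.part_def)
  moreover have "part \<delta> (Suc m) = 0"
    using True by (simp add: Defs.part_def)
  ultimately have "part ?\<epsilon> i \<le> part ?\<epsilon> (i + 1) + c i \<longleftrightarrow>
      (if i = Suc m then d \<le> c i else part \<delta> i \<le> part \<delta> (i + 1) + c i)"
    if "i \<in> {1..Suc m}" for i
    using that by auto
  then have "(\<forall>i\<in>{1..Suc m}. part ?\<epsilon> i \<le> part ?\<epsilon> (i + 1) + c i) \<longleftrightarrow>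
      (\<forall>i\<in>{1..m}. part \<delta> i \<le> part \<delta> (i + 1) + c i) \<and> d \<le> c (Suc m)"
    by (auto simp: atLeastAtMostSuc_conv)
  moreover have "is_partition ?\<epsilon> \<longleftrightarrow> is_partition \<delta>"
    by (simp add: sorted_wrt_append sorted_wrt_map)
  ultimately show ?thesis
    using True by (auto simp: bounded_diff_def)
qed (auto simp: bounded_diff_def)

lemma bij_betw_bounded_diff:
  "bij_betw (\<lambda>(\<delta>, d). map (\<lambda>x. x + d) \<delta> @ [d])
     (bounded_diff c m \<times> {..c (Suc m)}) (bounded_diff c (Suc m))"
proof (rule bij_betw_imageI)
  show "inj_on (\<lambda>(\<delta>, d). map (\<lambda>x. x + d) \<delta> @ [d]) (bounded_diff c m \<times> {..c (Suc m)})"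
    by (auto simp: inj_on_def dest!: map_injective simp: inj_def)
  show "(\<lambda>(\<delta>, d). map (\<lambda>x. x + d) \<delta> @ [d]) ` (bounded_diff c m \<times> {..c (Suc m)}) =
      bounded_diff c (Suc m)"
  proof (intro equalityI subsetI)
    fix \<epsilon> assume \<epsilon>: "\<epsilon> \<in> bounded_diff c (Suc m)"
    then have "length \<epsilon> = Suc m" "is_partition \<epsilon>"
      by (simp_all add: bounded_diff_def)
    then obtain xs d where \<epsilon>_eq: "\<epsilon> = xs @ [d]"
      by (metis length_0_conv nat.distinct(1) rev_exhaust)
    define \<delta> where "\<delta> = map (\<lambda>x. x - d) xs"
    have "\<forall>x\<in>set xs. d \<le> x"
      using \<open>is_partition \<epsilon>\<close> by (simp add: \<epsilon>_eq sorted_wrt_append)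
    then have "\<epsilon> = map (\<lambda>x. x + d) \<delta> @ [d]"
      by (simp add: \<epsilon>_eq \<delta>_def map_idI)
    then show "\<epsilon> \<in> (\<lambda>(\<delta>, d). map (\<lambda>x. x + d) \<delta> @ [d]) ` (bounded_diff c m \<times> {..c (Suc m)})"
      using \<epsilon> by (auto simp: bounded_diff_append intro!: image_eqI[of _ _ "(\<delta>, d)"])
  qed (auto simp: bounded_diff_append)
qed

lemma gen_poly_bounded_diff:
  "finite (bounded_diff c m) \<and>
   gen_poly sum_list (bounded_diff c m) * (\<Prod>i=1..m. 1 - q ^ i) =
     (\<Prod>i=1..m. 1 - q ^ (i * Suc (c i)))"
proof (rule gen_poly_independent_choices[where k = "\<lambda>i. i"])
  have "bounded_diff c 0 = {[]}"
    by (auto simp: bounded_diff_def)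
  then show "finite (bounded_diff c 0)" "gen_poly sum_list (bounded_diff c 0) = 1"
    by (simp_all add: gen_poly_def)
next
  fix m and \<delta> :: "nat list" and d
  assume "\<delta> \<in> bounded_diff c m"
  then show "sum_list (case (\<delta>, d) of (\<delta>, d) \<Rightarrow> map (\<lambda>x. x + d) \<delta> @ [d]) =
      sum_list \<delta> + Suc m * d"
    by (simp add: bounded_diff_def sum_list_addf sum_list_triv)
qed (rule bij_betw_bounded_diff)

section \<open>Partitions with bounded multiplicities\<close>

text \<open>
  Partitions with parts in \<open>[M + 1, M + m]\<close> in which \<open>M + i\<close> appears at most \<open>c i\<close> times.
\<close>

definition bounded_mult :: "nat \<Rightarrow> (nat \<Rightarrow> nat) \<Rightarrow> nat \<Rightarrow> nat list set" where
  "bounded_mult M c m = {\<pi>. is_partition \<pi> \<and> set \<pi> \<subseteq> {M + 1..M + m} \<and>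
     (\<forall>i\<in>{1..m}. count_list \<pi> (M + i) \<le> c i)}"

lemma is_partition_replicate: "is_partition (replicate n (x::nat))"
  by (induction n) auto

lemma count_list_replicate: "count_list (replicate n x) y = (if x = y then n else 0)"
  by (induction n) auto

lemma partition_split_max:
  assumes "is_partition \<pi>" and "\<forall>x\<in>set \<pi>. x \<le> (b::nat)"
  shows "\<pi> = replicate (count_list \<pi> b) b @ filter (\<lambda>x. x \<noteq> b) \<pi>"
  using assms
proof (induction \<pi>)
  case (Cons a \<pi>)
  show ?case
  proof (cases "a = b")
    case False
    then have "b \<notin> set \<pi>"
      using Cons.prems by force
    then have "count_list \<pi> b = 0" "filter (\<lambda>x. x \<noteq> b) \<pi> = \<pi>"
      by (auto simp: filter_id_conv count_list_0_iff)
    then show ?thesis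
      using False by simp
  qed (use Cons in auto)
qed simp

lemma bij_betw_bounded_mult:
  "bij_betw (\<lambda>(\<pi>, d). replicate d (M + Suc m) @ \<pi>)
     (bounded_mult M c m \<times> {..c (Suc m)}) (bounded_mult M c (Suc m))"
proof (rule bij_betw_byWitness)
  let ?b = "M + Suc m"
  let ?h = "\<lambda>(\<pi>, d). replicate d ?b @ \<pi>"
  let ?g = "\<lambda>\<pi>. (filter (\<lambda>x. x \<noteq> ?b) \<pi>, count_list \<pi> ?b)"
  have new: "?b \<notin> set \<pi>" if "\<pi> \<in> bounded_mult M c m" for \<pi>
    using that by (auto simp: bounded_mult_def)
  show "\<forall>x\<in>bounded_mult M c m \<times> {..c (Suc m)}. ?g (?h x) = x"
    using new by (auto simp: count_list_replicate count_list_0_iff filter_id_conv)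
  show "\<forall>\<pi>\<in>bounded_mult M c (Suc m). ?h (?g \<pi>) = \<pi>"
    by (auto simp: bounded_mult_def intro!: partition_split_max[symmetric])
  have "replicate d ?b @ \<pi> \<in> bounded_mult M c (Suc m)"
    if "\<pi> \<in> bounded_mult M c m" "d \<le> c (Suc m)" for \<pi> d
  proof -
    have "\<forall>y\<in>set \<pi>. M + 1 \<le> y \<and> y \<le> M + m"
      using that(1) by (auto simp: bounded_mult_def)
    then have "is_partition (replicate d ?b @ \<pi>)" "set (replicate d ?b @ \<pi>) \<subseteq> {M + 1..?b}"
      using that(1) by (auto simp: bounded_mult_def sorted_wrt_append is_partition_replicate)
    moreover have "count_list (replicate d ?b @ \<pi>) (M + i) \<le> c i" if "i \<in> {1..Suc m}" for i
      using that \<open>\<pi> \<in> bounded_mult M c m\<close> \<open>d \<le> c (Suc m)\<close> new[of \<pi>]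
      by (cases "i = Suc m") (auto simp: bounded_mult_def count_list_replicate count_list_0_iff)
    ultimately show ?thesis
      by (simp add: bounded_mult_def)
  qed
  then show "?h ` (bounded_mult M c m \<times> {..c (Suc m)}) \<subseteq> bounded_mult M c (Suc m)"
    by auto
  have "filter (\<lambda>x. x \<noteq> ?b) \<pi> \<in> bounded_mult M c m \<and> count_list \<pi> ?b \<le> c (Suc m)"
    if \<pi>: "\<pi> \<in> bounded_mult M c (Suc m)" for \<pi>
  proof -
    have "count_list (filter (\<lambda>x. x \<noteq> ?b) \<pi>) y = count_list \<pi> y" if "y \<noteq> ?b" for y
      using that by (induction \<pi>) auto
    then have "count_list (filter (\<lambda>x. x \<noteq> ?b) \<pi>) (M + i) \<le> c i" if "i \<in> {1..m}" for i
      using that \<pi> by (simp add: bounded_mult_def)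
    moreover have "count_list \<pi> ?b \<le> c (Suc m)"
      using \<pi> unfolding bounded_mult_def by force
    moreover have "x \<in> {M + 1..M + m}" if "x \<in> set \<pi>" "x \<noteq> ?b" for x
    proof -
      have "x \<in> {M + 1..?b}"
        using \<pi> that(1) by (auto simp: bounded_mult_def)
      then show ?thesis
        using that(2) by simp
    qed
    ultimately show ?thesis
      using \<pi> by (auto simp: bounded_mult_def sorted_wrt_filter)
  qed
  then show "?g ` bounded_mult M c (Suc m) \<subseteq> bounded_mult M c m \<times> {..c (Suc m)}"
    by auto
qed

lemma gen_poly_bounded_mult:
  "finite (bounded_mult M c m) \<and>
   gen_poly sum_list (bounded_mult M c m) * (\<Prod>i=1..m. 1 - q ^ (M + i)) =
     (\<Prod>i=1..m. 1 - q ^ ((M + i) * Suc (c i)))"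
proof (rule gen_poly_independent_choices[where k = "\<lambda>i. M + i"])
  have "bounded_mult M c 0 = {[]}"
    by (auto simp: bounded_mult_def)
  then show "finite (bounded_mult M c 0)" "gen_poly sum_list (bounded_mult M c 0) = 1"
    by (simp_all add: gen_poly_def)
next
  fix m and \<pi> :: "nat list" and d
  show "sum_list (case (\<pi>, d) of (\<pi>, d) \<Rightarrow> replicate d (M + Suc m) @ \<pi>) =
      sum_list \<pi> + (M + Suc m) * d"
    by (simp add: sum_list_replicate)
qed (rule bij_betw_bounded_mult)

section \<open>Partitions in a box\<close>

text \<open>Partitions with \<open>N\<close> nonnegative parts, each at most \<open>M\<close>.\<close>

definition box :: "nat \<Rightarrow> nat \<Rightarrow> nat list set" where
  "box N M = {\<mu>. length \<mu> = N \<and> is_partition \<mu> \<and> (\<forall>p\<in>set \<mu>. p \<le> M)}"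

lemma finite_box: "finite (box N M)"
  by (rule finite_subset[OF _ finite_lists_length_eq[of "{..M}" N]]) (auto simp: box_def)

text \<open>
  The recurrence of the Gaussian binomial coefficients, by whether the largest part attains the
  bound.
\<close>

lemma gen_poly_box_Suc_Suc:
  "gen_poly sum_list (box (Suc N) (Suc M)) =
     gen_poly sum_list (box (Suc N) M) + q ^ Suc M * gen_poly sum_list (box N (Suc M))"
proof -
  have split: "box (Suc N) (Suc M) = box (Suc N) M \<union> (#) (Suc M) ` box N (Suc M)"
  proof (intro equalityI subsetI)
    fix \<mu> assume \<mu>: "\<mu> \<in> box (Suc N) (Suc M)"
    then obtain a xs where \<mu>_eq: "\<mu> = a # xs"
      by (auto simp: box_def length_Suc_conv)
    show "\<mu> \<in> box (Suc N) M \<union> (#) (Suc M) ` box N (Suc M)"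
      using \<mu> by (cases "a = Suc M") (fastforce simp: box_def \<mu>_eq)+
  qed (fastforce simp: box_def)
  have disj: "box (Suc N) M \<inter> (#) (Suc M) ` box N (Suc M) = {}"
    by (auto simp: box_def)
  show ?thesis
    unfolding split gen_poly_def
    by (subst sum.union_disjoint)
      (use disj in \<open>simp_all add: finite_box sum.reindex sum_distrib_left power_add mult.assoc\<close>)
qed

lemma gen_poly_box:
  "gen_poly sum_list (box N M) * (\<Prod>i=1..N. 1 - q ^ i) = (\<Prod>i=1..N. 1 - q ^ (M + i))"
proof (induction "N + M" arbitrary: N M rule: less_induct)
  case less
  consider "N = 0" | "M = 0" | N' M' where "N = Suc N'" "M = Suc M'"
    by (cases N; cases M) auto
  then show ?case
  proof cases
    case 1
    then have "box N M = {[]}" by (auto simp: box_def)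
    then show ?thesis using 1 by (simp add: gen_poly_def)
  next
    case 2
    have "box N M = {replicate N 0}"
      by (auto simp: 2 box_def is_partition_replicate intro!: replicate_eqI)
    then show ?thesis using 2 by (simp add: gen_poly_def sum_list_replicate)
  next
    case (3 N' M')
    define P where "P = (\<Prod>i=1..N'. 1 - q ^ (M + i))"
    \<comment> \<open>Shifting the index by one turns the numerator for \<open>(N, M')\<close> into \<open>P\<close> times its first factor.\<close>
    have shift: "(\<Prod>i=1..N. 1 - q ^ (M' + i)) = (1 - q ^ M) * P"
      unfolding P_def using 3
      by (simp add: prod.atLeast_Suc_atMost prod.shift_bounds_cl_Suc_ivl del: prod.cl_ivl_Suc)
    have IH1: "gen_poly sum_list (box N M') * (\<Prod>i=1..N. 1 - q ^ i) = (1 - q ^ M) * P"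
      using less[of N M'] 3 shift by simp
    have IH2: "gen_poly sum_list (box N' M) * (\<Prod>i=1..N'. 1 - q ^ i) = P"
      using less[of N' M] 3 unfolding P_def by simp
    have "gen_poly sum_list (box N M) * (\<Prod>i=1..N. 1 - q ^ i) =
        gen_poly sum_list (box N M') * (\<Prod>i=1..N. 1 - q ^ i) +
        q ^ M * (gen_poly sum_list (box N' M) * (\<Prod>i=1..N'. 1 - q ^ i)) * (1 - q ^ N)"
      using 3 by (simp add: gen_poly_box_Suc_Suc algebra_simps)
    also have "\<dots> = P * (1 - q ^ (M + N))"
      unfolding IH1 IH2 by (simp add: algebra_simps power_add)
    also have "\<dots> = (\<Prod>i=1..N. 1 - q ^ (M + i))"
      using 3 unfolding P_def by simp
    finally show ?thesis .
  qed
qed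

section \<open>Comparison of the two sets\<close>

lemma C_set_eq:
  "C_set M N n = {\<delta> \<in> bounded_diff (\<lambda>i. M + N - i) N. sum_list \<delta> = n}"
proof -
  \<comment> \<open>The lower bound in \<open>C_set\<close> follows from the order of the parts.\<close>
  have "part \<delta> (i + 1) \<le> part \<delta> i" if "is_partition \<delta>" "i \<ge> 1" for \<delta> i
    using that by (cases "i < length \<delta>") (auto simp: Defs.part_def sorted_wrt_iff_nth_less)
  then have "(0 \<le> int (part \<delta> i) - int (part \<delta> (i + 1)) \<and>
        int (part \<delta> i) - int (part \<delta> (i + 1)) \<le> int M + int N - int i) \<longleftrightarrow>
      part \<delta> i \<le> part \<delta> (i + 1) + (M + N - i)"
    if "is_partition \<delta>" "i \<in> {1..N}" for \<delta> i
    using that by (auto simp: of_nat_diff)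
  then show ?thesis
    unfolding C_set_def bounded_diff_def
    by (intro Collect_cong) (simp only: mem_Collect_eq, metis (no_types, lifting))
qed

lemma D_set_eq:
  assumes "N > 0"
  shows "D_set M N n =
    {x \<in> bounded_mult M (\<lambda>i. N - i) (N - 1) \<times> box N M.
       (case x of (\<pi>, \<mu>) \<Rightarrow> sum_list \<pi> + sum_list \<mu>) = n}"
  using assms unfolding D_set_def bounded_mult_def box_def by auto

theorem theorem1p10:
  fixes M N n :: nat
  assumes "M > 0" and "N > 0"
  shows "\<exists>\<psi>. bij_betw \<psi> (C_set M N n) (D_set M N n)"
proof -
  define A where "A = bounded_diff (\<lambda>i. M + N - i) N"
  define B where "B = bounded_mult M (\<lambda>i. N - i) (N - 1)"
  define w where "w = (\<lambda>(\<pi>::nat list, \<mu>::nat list). sum_list \<pi> + sum_list \<mu>)"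
  define Q where "Q = (\<Prod>i=1..N. 1 - q ^ i)"
  have fin: "finite A" "finite (B \<times> box N M)"
    using gen_poly_bounded_diff gen_poly_bounded_mult finite_box by (auto simp: A_def B_def)
  have Q_nonzero: "Q \<noteq> 0"
    by (auto simp: Q_def monom_power monom_eq_1_iff)
  have last_factor: "(\<Prod>i=1..N. f i) = (\<Prod>i=1..N - 1. f i) * f N" for f :: "nat \<Rightarrow> int poly"
    using \<open>N > 0\<close> by (cases N) simp_all
  have "gen_poly w (B \<times> box N M) * Q =
      gen_poly sum_list B * (gen_poly sum_list (box N M) * Q)"
    unfolding w_def gen_poly_Times by (rule mult.assoc)
  also have "\<dots> = gen_poly sum_list B * (\<Prod>i=1..N - 1. 1 - q ^ (M + i)) * (1 - q ^ (M + N))"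
    unfolding Q_def gen_poly_box last_factor[of "\<lambda>i. 1 - q ^ (M + i)"]
    by (simp only: mult.assoc)
  also have "\<dots> = (\<Prod>i=1..N. 1 - q ^ ((M + i) * Suc (N - i)))"
    using gen_poly_bounded_mult unfolding B_def last_factor by simp
  also have "\<dots> = (\<Prod>i=1..N. 1 - q ^ (i * Suc (M + N - i)))"
    by (rule prod.reindex_bij_witness[of _ "\<lambda>i. Suc N - i" "\<lambda>i. Suc N - i"])
      (auto simp: Suc_diff_le mult.commute)
  also have "\<dots> = gen_poly sum_list A * Q"
    using gen_poly_bounded_diff unfolding A_def Q_def by simp
  finally have "gen_poly sum_list A = gen_poly w (B \<times> box N M)"
    using Q_nonzero by simp
  then have "int (card {\<delta> \<in> A. sum_list \<delta> = n}) = int (card {x \<in> B \<times> box N M. w x = n})"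
    by (simp only: coeff_gen_poly[OF fin(1), symmetric] coeff_gen_poly[OF fin(2), symmetric])
  moreover have "C_set M N n = {\<delta> \<in> A. sum_list \<delta> = n}"
    unfolding A_def by (rule C_set_eq)
  moreover have "D_set M N n = {x \<in> B \<times> box N M. w x = n}"
    unfolding B_def w_def by (rule D_set_eq[OF \<open>N > 0\<close>])
  ultimately have "card (C_set M N n) = card (D_set M N n)"
      "finite (C_set M N n)" "finite (D_set M N n)"
    using fin by simp_all
  then show ?thesis
    by (rule finite_same_card_bij[rotated 2])
qed

end
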